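(* Let $p$ be a prime and let $G$ be a non-abelian group of order $p^6$. Then $\mathrm{Aut}_c(G)=\mathrm{Aut}_z(G)$ if and only if either ($\gamma_2(G)=Z(G)$ and $Z(G)$ is cyclic) or $G$ is a Camina $p$-group of nilpotency class $2$.
   Context: $Z(G)$ is the center and $\gamma_2(G)$ the commutator subgroup of $G$. $\mathrm{Aut}_c(G)$ is the group of all class preserving automorphisms of $G$, i.e. automorphisms $\alpha$ such that $\alpha(x)$ is conjugate to $x$ in $G$ for every $x\in G$. $\mathrm{Aut}_z(G)$ is the group of all central automorphisms of $G$, i.e. automorphisms $\phi$ such that $g^{-1}\phi(g)\in Z(G)$ for every $g\in G$. Commutators are $[x,y]=x^{-1}y^{-1}xy$, and for $y\in G$, $[y,G]$ denotes the set $\{[y,g] : g\in G\}$. For a non-trivial proper normal subgroup $M$ of a finite $p$-group $G$, the pair $(G,M)$ is a Camina pair if $M\subseteq [y,G]$ for all $y\in G\setminus M$; $G$ is a Camina group if $(G,\gamma_2(G))$ is a Camina pair. *)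

theory Defs
  imports
    "HOL-Computational_Algebra.Primes"
    "HOL-Algebra.Bij"
    "HOL-Algebra.Elementary_Groups"
begin

definition center :: "('a, 'b) monoid_scheme \<Rightarrow> 'a set" where
  "center G = {z \<in> carrier G. \<forall>g \<in> carrier G. z \<otimes>\<^bsub>G\<^esub> g = g \<otimes>\<^bsub>G\<^esub> z}"

definition commutator :: "('a, 'b) monoid_scheme \<Rightarrow> 'a \<Rightarrow> 'a \<Rightarrow> 'a" where
  "commutator G x y = inv\<^bsub>G\<^esub> x \<otimes>\<^bsub>G\<^esub> inv\<^bsub>G\<^esub> y \<otimes>\<^bsub>G\<^esub> x \<otimes>\<^bsub>G\<^esub> y"

text \<open>The library's \<^const>\<open>derived\<close> uses the commutator convention
  \<open>x y x\<^sup>-\<^sup>1 y\<^sup>-\<^sup>1\<close>; by \<open>gamma2_eq\<close> below it is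
  the same subgroup as the one generated by the commutators in the convention used here.\<close>

abbreviation gamma2 :: "('a, 'b) monoid_scheme \<Rightarrow> 'a set" where
  "gamma2 G \<equiv> derived G (carrier G)"

text \<open>\<open>lower_central G n\<close> is the term with index \<open>n + 1\<close> of the lower central series
  in the usual numbering, which starts with \<open>\<gamma>\<^sub>1(G) = G\<close>.\<close>

primrec lower_central :: "('a, 'b) monoid_scheme \<Rightarrow> nat \<Rightarrow> 'a set" where
  "lower_central G 0 = carrier G"
| "lower_central G (Suc n) =
     generate G {commutator G x g | x g. x \<in> lower_central G n \<and> g \<in> carrier G}"

definition nilpotent_of_class :: "('a, 'b) monoid_scheme \<Rightarrow> nat \<Rightarrow> bool" where
  "nilpotent_of_class G c \<longleftrightarrow>
     lower_central G c = {\<one>\<^bsub>G\<^esub>} \<and> (\<forall>d < c. lower_central G d \<noteq> {\<one>\<^bsub>G\<^esub>})"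

text \<open>Both are sets of elements of \<^const>\<open>auto\<close>, the carrier of \<^const>\<open>AutoGroup\<close>;
  automorphisms are thus extensional functions (\<^const>\<open>undefined\<close> off the carrier).\<close>

definition Aut_c :: "('a, 'b) monoid_scheme \<Rightarrow> ('a \<Rightarrow> 'a) set" where
  "Aut_c G = {\<alpha> \<in> auto G. \<forall>x \<in> carrier G. \<exists>g \<in> carrier G. \<alpha> x = inv\<^bsub>G\<^esub> g \<otimes>\<^bsub>G\<^esub> x \<otimes>\<^bsub>G\<^esub> g}"

definition Aut_z :: "('a, 'b) monoid_scheme \<Rightarrow> ('a \<Rightarrow> 'a) set" where
  "Aut_z G = {\<phi> \<in> auto G. \<forall>g \<in> carrier G. inv\<^bsub>G\<^esub> g \<otimes>\<^bsub>G\<^esub> \<phi> g \<in> center G}"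

definition finite_p_group :: "nat \<Rightarrow> ('a, 'b) monoid_scheme \<Rightarrow> bool" where
  "finite_p_group p G \<longleftrightarrow> prime p \<and> group G \<and> (\<exists>n. order G = p ^ n)"

definition camina_pair :: "nat \<Rightarrow> ('a, 'b) monoid_scheme \<Rightarrow> 'a set \<Rightarrow> bool" where
  "camina_pair p G M \<longleftrightarrow>
     finite_p_group p G \<and> M \<lhd> G \<and> M \<noteq> {\<one>\<^bsub>G\<^esub>} \<and> M \<noteq> carrier G \<and>
     (\<forall>y \<in> carrier G - M. M \<subseteq> {commutator G y g | g. g \<in> carrier G})"

definition camina_p_group :: "nat \<Rightarrow> ('a, 'b) monoid_scheme \<Rightarrow> bool" where
  "camina_p_group p G \<longleftrightarrow> camina_pair p G (gamma2 G)"

lemma (in group) gamma2_eq: "gamma2 G = lower_central G 1"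
proof -
  have "derived_set G (carrier G) = {commutator G x g | x g. x \<in> carrier G \<and> g \<in> carrier G}"
    (is "?A = ?B")
  proof
    show "?A \<subseteq> ?B"
    proof
      fix c assume "c \<in> ?A"
      then obtain x y where *: "x \<in> carrier G" "y \<in> carrier G" "c = x \<otimes> y \<otimes> inv x \<otimes> inv y"
        by blast
      then have "c = commutator G (inv x) (inv y)" by (simp add: commutator_def)
      then show "c \<in> ?B" using * inv_closed by blast
    qed
    show "?B \<subseteq> ?A"
    proof
      fix c assume "c \<in> ?B"
      then obtain x y where *: "x \<in> carrier G" "y \<in> carrier G" "c = commutator G x y"
        by blast
      then have "c = inv x \<otimes> inv y \<otimes> inv (inv x) \<otimes> inv (inv y)"
        by (simp add: commutator_def)
      then show "c \<in> ?A" using * inv_closed by blast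
    qed
  qed
  then show ?thesis by (simp add: derived_def)
qed

end

theory Submission
  imports Defs "HOL-Algebra.Multiplicative_Group"
begin

text \<open>Inner automorphisms are class preserving, so \<open>Aut_c G \<subseteq> Aut_z G\<close> means that \<open>G\<close> has class
  at most 2, and then every \<open>[x, G]\<close> is a subgroup of \<open>Z(G)\<close>. A central automorphism is
  \<open>x \<mapsto> x f(x)\<close> for a homomorphism \<open>f : G \<rightarrow> Z(G)\<close>, and it is class preserving iff
  \<open>f(x) \<in> [x, G]\<close> for all \<open>x\<close>. In particular \<open>f\<close> must kill \<open>Z(G)\<close> and have image in
  \<open>\<gamma>\<^sub>2(G)\<close>. If there were a central element \<open>u \<notin> \<gamma>\<^sub>2(G)\<close>, a cyclic quotient of \<open>G/\<gamma>\<^sub>2(G)\<close> in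
  which \<open>u\<close> survives would give an \<open>f\<close> violating one of the two, so \<open>\<gamma>\<^sub>2(G) = Z(G)\<close>.

  If all commutators have order dividing \<open>p\<close>, then \<open>G/Z(G)\<close> and \<open>Z(G)\<close> are elementary abelian, so
  for \<open>x \<notin> Z(G)\<close> the values \<open>f(x)\<close> exhaust \<open>Z(G)\<close> and \<open>G\<close> is a Camina group. Otherwise some
  \<open>c = [x, g]\<close> has order \<open>p\<^sup>e\<close> with \<open>e \<ge> 2\<close>. The \<open>p\<^sup>2\<^sup>e\<close> elements \<open>x\<^sup>i g\<^sup>j\<close> are distinct modulo
  \<open>Z(G)\<close>, hence \<open>|Z(G)| \<le> p\<^sup>6\<^sup>-\<^sup>2\<^sup>e \<le> p\<^sup>2 \<le> |c|\<close> and \<open>Z(G)\<close> is generated by \<open>c\<close>.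

  Conversely, if \<open>\<gamma>\<^sub>2(G) = Z(G)\<close> is cyclic and \<open>k = |[x, G]|\<close>, then \<open>x\<^sup>k \<in> Z(G) = \<gamma>\<^sub>2(G)\<close>, so
  \<open>f(x)\<^sup>k = 1\<close>, which puts \<open>f(x)\<close> into the only subgroup of order \<open>k\<close>, namely \<open>[x, G]\<close>.\<close>

section \<open>Cyclic quotients of finite p-groups\<close>

lemma prime_not_dvd_inverse:
  fixes j :: int
  assumes "prime p" "\<not> int p dvd j"
  obtains j' q where "j * j' = 1 - int p * q"
proof -
  have "coprime j (int p)"
    using assms prime_imp_coprime[of "int p" j] by (simp add: coprime_commute)
  then obtain a b where "a * j + b * int p = 1" using bezout_int[of j "int p"] by auto
  then have "j * a = 1 - int p * b" by (simp add: algebra_simps)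
  then show thesis using that by blast
qed

text \<open>An element \<open>w\<close> of maximal order generates: if \<open>x \<notin> \<langle>w\<rangle>\<close> but \<open>x\<^sup>p = w\<^sup>i\<close>, maximality gives
  \<open>p dvd i\<close>, so \<open>x\<close> times a power of \<open>w\<close> has order \<open>p\<close> and generates the same subgroup as \<open>u\<close>,
  which lies in \<open>\<langle>w\<rangle>\<close>.\<close>

lemma (in comm_group) cyclic_if_common_power:
  assumes fin: "finite (carrier G)" and p: "prime p" and ord: "order G = p ^ n"
    and u: "u \<in> carrier G" "u \<noteq> \<one>"
    and min: "\<And>a. a \<in> carrier G \<Longrightarrow> a \<noteq> \<one> \<Longrightarrow> \<exists>i::int. u = a [^] i"
  obtains w where "w \<in> carrier G" "carrier G = range (\<lambda>i::int. w [^] i)"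
proof -
  have ordp: "\<exists>k. ord x = p ^ k" if "x \<in> carrier G" for x
    using ord_dvd_group_order[OF that] ord p divides_primepow_nat by auto
  obtain w where w: "w \<in> carrier G" "\<And>x. x \<in> carrier G \<Longrightarrow> ord x \<le> ord w"
  proof -
    have "Max (ord ` carrier G) \<in> ord ` carrier G"
      using fin u(1) by (intro Max_in) auto
    then obtain w where "w \<in> carrier G" "ord w = Max (ord ` carrier G)" by auto
    then show thesis using that fin by simp
  qed
  obtain r where r: "ord w = p ^ r" using ordp w(1) by blast
  have exponent: "x [^] (p ^ r) = \<one>" if x: "x \<in> carrier G" for x
  proof -
    obtain s where s: "ord x = p ^ s" using ordp[OF x] by blast
    have "p ^ s \<le> p ^ r" using w(2)[OF x] unfolding s r .
    then have "s \<le> r" by (rule power_le_imp_le_exp[OF prime_gt_1_nat[OF p]])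
    then show ?thesis using x s by (simp add: pow_eq_id le_imp_power_dvd)
  qed
  have "w \<noteq> \<one>"
    using w(2)[OF u(1)] ord_ge_1[OF fin u(1)] ord_eq_1[OF u(1)] u(2) by auto
  then have "r \<noteq> 0" using r ord_eq_1[OF w(1)] by (metis power_0)
  then obtain r' where r': "r = Suc r'" using not0_implies_Suc by blast
  have sub: "subgroup (range (\<lambda>i::int. w [^] i)) G" (is "subgroup ?W G")
    using subgroup_of_powers w(1) .
  have "carrier G \<subseteq> ?W"
  proof (rule ccontr)
    assume "\<not> carrier G \<subseteq> ?W"
    then obtain x0 where x0: "x0 \<in> carrier G" "x0 \<notin> ?W" by blast
    \<comment> \<open>Iterated \<open>p\<close>-th powers of \<open>x0\<close> eventually enter
      \<open>?W\<close>; the last one outside serves as \<open>x\<close>, so \<open>x [^] p\<close>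
      is a power of \<open>w\<close>.\<close>
    define k where "k = (LEAST k. x0 [^] (p ^ k) \<in> ?W)"
    have ex: "x0 [^] (p ^ r) \<in> ?W" using exponent[OF x0(1)] subgroup.one_closed[OF sub] by simp
    have k: "x0 [^] (p ^ k) \<in> ?W" unfolding k_def by (rule LeastI, rule ex)
    have "k \<noteq> 0" using k x0 by (intro notI) simp
    then obtain k' where k': "k = Suc k'" using not0_implies_Suc by blast
    define x where "x = x0 [^] (p ^ k')"
    have x: "x \<in> carrier G" "x \<notin> ?W"
      using not_less_Least[of k' "\<lambda>k. x0 [^] (p ^ k) \<in> ?W"] x0(1) k'
      by (auto simp: x_def k_def)
    have "x [^] p \<in> ?W" using k x0(1) by (simp add: x_def k' nat_pow_pow mult.commute)
    then obtain i :: int where i: "x [^] p = w [^] i" by blast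
    \<comment> \<open>The value is \<open>x [^] (p ^ r)\<close>, which is \<open>\<one>\<close>
      because \<open>p ^ r\<close> is the largest order; so \<open>p ^ r\<close> divides
      \<open>i * p ^ r'\<close>, where \<open>r = Suc r'\<close>.\<close>
    have "w [^] (i * int (p ^ r')) = (x [^] p) [^] (p ^ r')"
      unfolding i by (metis int_pow_int int_pow_pow w(1))
    also have "\<dots> = x [^] (p ^ r)"
      using x(1) by (simp add: nat_pow_pow r')
    finally have "int (p ^ r) dvd i * int (p ^ r')"
      using exponent[OF x(1)] int_pow_eq_id[OF w(1)] r by simp
    then have "int p dvd i"
      using prime_gt_0_nat[OF p] by (simp add: r')
    then obtain l where l: "i = int p * l" ..
    define y where "y = x \<otimes> inv (w [^] l)"
    have y: "y \<in> carrier G" using x w by (simp add: y_def)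
    have "y [^] p = x [^] p \<otimes> inv (w [^] l) [^] p"
      unfolding y_def using x w by (intro nat_pow_distrib) auto
    also have "inv (w [^] l) [^] p = inv (w [^] i)"
      using w(1) by (simp add: l int_pow_pow mult.commute flip: int_pow_int int_pow_inv)
    finally have yp: "y [^] p = \<one>" using i w(1) by simp
    have yW: "y \<notin> ?W"
    proof
      assume "y \<in> ?W"
      then have "y \<otimes> w [^] l \<in> ?W" using subgroup.m_closed[OF sub] by blast
      then show False using x w by (simp add: y_def m_assoc)
    qed
    then have "y \<noteq> \<one>" using subgroup.one_closed[OF sub] by auto
    then obtain j :: int where j: "u = y [^] j" using min y by blast
    have ordy: "ord y = p"
      using yp y \<open>y \<noteq> \<one>\<close> p by (metis ord_eq_1 pow_eq_id prime_nat_iff)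
    then have "\<not> int p dvd j" using j u(2) int_pow_eq_id[OF y] by auto
    then obtain j' q where "j * j' = 1 - int p * q" using prime_not_dvd_inverse p by blast
    then have "y = y [^] (j * j')"
      using int_pow_eq[OF y, of 1 "j * j'"] ordy y by simp
    then have "y = u [^] j'" using y j by (simp add: int_pow_pow)
    moreover have "u \<in> ?W" using min[OF w(1) \<open>w \<noteq> \<one>\<close>] by blast
    ultimately have "y \<in> ?W" using subgroup_int_pow_closed[OF sub] by simp
    with yW show False ..
  qed
  then show thesis using that[OF w(1)] w(1) by blast
qed

text \<open>Conjugating \<open>h\<close> by \<open>x\<close> multiplies it by a commutator, which
  lies in \<open>M\<close>; likewise \<open>x \<otimes> y\<close> and \<open>y \<otimes> x\<close>
  differ by an element of \<open>M\<close>.\<close>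

lemma (in group) subgroup_above_derived:
  assumes M: "subgroup M G" and derived: "derived G (carrier G) \<subseteq> M"
  shows "M \<lhd> G" and "comm_group (G Mod M)"
proof -
  have comm: "x \<otimes> y \<otimes> inv x \<otimes> inv y \<in> M" if "x \<in> carrier G" "y \<in> carrier G" for x y
    using that derived unfolding derived_def by (blast intro: generate.incl)
  show N: "M \<lhd> G"
    unfolding normal_inv_iff
  proof (intro conjI ballI M)
    fix x h assume x: "x \<in> carrier G" and h: "h \<in> M"
    have h': "h \<in> carrier G" using subgroup.mem_carrier[OF M h] .
    have "x \<otimes> h \<otimes> inv x \<otimes> inv h \<otimes> h \<in> M"
      by (intro subgroup.m_closed[OF M] comm x h' h)
    then show "x \<otimes> h \<otimes> inv x \<in> M" using x h' by (simp add: m_assoc)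
  qed
  interpret N: normal M G by (rule N)
  interpret Q: group "G Mod M" by (rule N.factorgroup_is_group)
  show "comm_group (G Mod M)"
  proof (rule Q.group_comm_groupI)
    fix X Y assume "X \<in> carrier (G Mod M)" "Y \<in> carrier (G Mod M)"
    then obtain x y where xy: "x \<in> carrier G" "y \<in> carrier G" "X = M #> x" "Y = M #> y"
      by (auto simp: carrier_FactGroup)
    have "x \<otimes> y \<otimes> inv (y \<otimes> x) \<in> M"
      using comm[OF xy(1,2)] xy by (simp add: inv_mult_group m_assoc)
    then have "x \<otimes> y \<in> M #> (y \<otimes> x)" using N.rcos_module xy is_group by simp
    then have "M #> (x \<otimes> y) = M #> (y \<otimes> x)"
      using repr_independence[OF _ _ M] xy by simp
    then show "X \<otimes>\<^bsub>G Mod M\<^esub> Y = Y \<otimes>\<^bsub>G Mod M\<^esub> X" using xy by (simp add: N.rcos_sum)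
  qed
qed

lemma (in group) coset_eq_subgroup_iff:
  assumes "subgroup M G" "x \<in> carrier G"
  shows "M #> x = M \<longleftrightarrow> x \<in> M"
  using assms coset_join1 coset_join2 by (metis subgroup.subset)

text \<open>Read modulo \<open>p\<^sup>r\<close>, the function \<open>e\<close> is a homomorphism onto a cyclic group. Its kernel is
  maximal among the subgroups that contain \<open>N\<close> but not \<open>u\<close>, so the image of \<open>u\<close> lies in every
  nontrivial subgroup of the quotient; this forces the quotient to be cyclic.\<close>

lemma (in group) separating_exponent_map:
  assumes p: "prime p" and ord: "order G = p ^ n"
    and N: "subgroup N G" and derived: "derived G (carrier G) \<subseteq> N"
    and u: "u \<in> carrier G" "u \<notin> N"
  obtains w r and e :: "'a \<Rightarrow> int" where "w \<in> carrier G" "int (p ^ r) dvd e w - 1"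
    "\<And>x y. x \<in> carrier G \<Longrightarrow> y \<in> carrier G \<Longrightarrow> int (p ^ r) dvd e (x \<otimes> y) - (e x + e y)"
    "\<And>x. x \<in> N \<Longrightarrow> int (p ^ r) dvd e x"
    "\<not> int (p ^ r) dvd e u" "int (p ^ r) dvd int p * e u"
proof -
  have fin: "finite (carrier G)"
    using ord p order_gt_0_iff_finite by (simp add: prime_gt_0_nat)
  define S where "S = {M. subgroup M G \<and> N \<subseteq> M \<and> u \<notin> M}"
  have "N \<in> S" using N u by (simp add: S_def)
  moreover have "finite S"
    by (rule finite_subset[of _ "Pow (carrier G)"]) (auto simp: S_def fin dest: subgroup.subset)
  ultimately obtain M where "M \<in> S" and max: "\<And>K. K \<in> S \<Longrightarrow> M \<subseteq> K \<Longrightarrow> M = K"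
    using finite_has_maximal[of S] by blast
  then have M: "subgroup M G" "N \<subseteq> M" "u \<notin> M" by (auto simp: S_def)
  have "derived G (carrier G) \<subseteq> M" using derived M(2) by blast
  note Mn = subgroup_above_derived[OF M(1) this]
  interpret N: normal M G by (rule Mn)
  define A where "A = G Mod M"
  interpret A: comm_group A unfolding A_def by (rule Mn)
  have carrier_A: "carrier A = (\<lambda>x. M #> x) ` carrier G" by (simp add: A_def carrier_FactGroup)
  have finA: "finite (carrier A)" using fin by (simp add: carrier_A)
  have one_A: "\<one>\<^bsub>A\<^esub> = M" by (simp add: A_def)
  have mult_A: "(M #> x) \<otimes>\<^bsub>A\<^esub> (M #> y) = M #> (x \<otimes> y)" if "x \<in> carrier G" "y \<in> carrier G" for x y
    using that by (simp add: A_def N.rcos_sum)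
  have pow_A: "(M #> x) [^]\<^bsub>A\<^esub> i = M #> (x [^] i)" if "x \<in> carrier G" for x and i :: int
    using that by (simp add: A_def N.FactGroup_int_pow)
  have "order A * card M = p ^ n"
    using lagrange[OF M(1)] ord by (simp add: A_def order_def FactGroup_def)
  then obtain m where m: "order A = p ^ m"
    using divides_primepow_nat[OF p] by (metis dvd_triv_left)
  let ?U = "M #> u"
  have U: "?U \<in> carrier A" "?U \<noteq> \<one>\<^bsub>A\<^esub>"
    using u M coset_eq_subgroup_iff by (auto simp: carrier_A one_A)
  have min: "\<exists>i::int. ?U = a [^]\<^bsub>A\<^esub> i" if a: "a \<in> carrier A" "a \<noteq> \<one>\<^bsub>A\<^esub>" for a
  proof (rule ccontr)
    assume no: "\<not> ?thesis"
    obtain x where x: "x \<in> carrier G" "a = M #> x" using a(1) by (auto simp: carrier_A)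
    have "x \<notin> M" using x a(2) M(1) coset_eq_subgroup_iff by (auto simp: one_A)
    \<comment> \<open>The preimage of the powers of \<open>a\<close>: it contains \<open>M\<close>
      properly because of \<open>x\<close>, yet misses \<open>u\<close>, against the maximality of
      \<open>M\<close>.\<close>
    define K where "K = {g \<in> carrier G. \<exists>i::int. M #> g = a [^]\<^bsub>A\<^esub> i}"
    have "subgroup K G"
    proof (rule subgroupI)
      show "K \<subseteq> carrier G" by (auto simp: K_def)
      have "\<one> \<in> K" unfolding K_def using N.subset by (auto simp: one_A intro!: exI[of _ 0])
      then show "K \<noteq> {}" by blast
    next
      fix g assume "g \<in> K"
      then obtain i :: int where g: "g \<in> carrier G" "M #> g = a [^]\<^bsub>A\<^esub> i" by (auto simp: K_def)
      have "M #> inv g = a [^]\<^bsub>A\<^esub> (- i)"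
        using pow_A[OF g(1), of "-1"] g a(1) by (simp add: int_pow_neg A.int_pow_neg)
      then show "inv g \<in> K" using g by (auto simp: K_def)
    next
      fix g h assume "g \<in> K" "h \<in> K"
      then obtain i j :: int where g: "g \<in> carrier G" "M #> g = a [^]\<^bsub>A\<^esub> i"
        and h: "h \<in> carrier G" "M #> h = a [^]\<^bsub>A\<^esub> j" by (auto simp: K_def)
      have "M #> (g \<otimes> h) = a [^]\<^bsub>A\<^esub> (i + j)"
        using g h a(1) by (simp add: A.int_pow_mult flip: mult_A)
      then show "g \<otimes> h \<in> K" using g h by (auto simp: K_def)
    qed
    moreover have "M \<subseteq> K"
    proof
      fix g assume g: "g \<in> M"
      then have "M #> g = a [^]\<^bsub>A\<^esub> (0::int)" using coset_eq_subgroup_iff M(1) by (simp add: one_A)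
      then show "g \<in> K" using g N.subset unfolding K_def by blast
    qed
    moreover have "x \<in> K" using x a(1) by (auto simp: K_def intro!: exI[of _ 1])
    moreover have "u \<notin> K" using no by (auto simp: K_def)
    ultimately show False using max[of K] M(2) \<open>x \<notin> M\<close> by (auto simp: S_def)
  qed
  obtain W where W: "W \<in> carrier A" "carrier A = range (\<lambda>i::int. W [^]\<^bsub>A\<^esub> i)"
    using A.cyclic_if_common_power[OF finA p m U min] by blast
  obtain w where w: "w \<in> carrier G" "W = M #> w" using W(1) by (auto simp: carrier_A)
  obtain r where r: "A.ord W = p ^ r"
    using A.ord_dvd_group_order[OF W(1)] m divides_primepow_nat[OF p] by auto
  \<comment> \<open>A discrete logarithm to the base \<open>W\<close>; whichever exponent is chosen,
    it is determined modulo the order \<open>p ^ r\<close> of \<open>W\<close>.\<close>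
  define e where "e x = (SOME i::int. M #> x = W [^]\<^bsub>A\<^esub> i)" for x
  have e: "M #> x = W [^]\<^bsub>A\<^esub> e x" if "x \<in> carrier G" for x
  proof -
    have "M #> x \<in> range (\<lambda>i::int. W [^]\<^bsub>A\<^esub> i)" using that W(2) by (auto simp: carrier_A)
    then have "\<exists>i::int. M #> x = W [^]\<^bsub>A\<^esub> i" by blast
    then show ?thesis unfolding e_def by (rule someI_ex)
  qed
  have eqI: "int (p ^ r) dvd i - j" if "W [^]\<^bsub>A\<^esub> i = W [^]\<^bsub>A\<^esub> j" for i j
    using A.int_pow_eq[OF W(1), of j i] that r by simp
  have e_one: "int (p ^ r) dvd e x \<longleftrightarrow> x \<in> M" if "x \<in> carrier G" for x
    using A.int_pow_eq_id[OF W(1), of "e x"] r e[OF that] coset_eq_subgroup_iff[OF M(1) that] one_A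
    by simp
  show thesis
  proof
    show "w \<in> carrier G" by fact
    show "int (p ^ r) dvd e w - 1" using e[OF w(1)] w(2) W(1) by (intro eqI) simp
    show "int (p ^ r) dvd e (x \<otimes> y) - (e x + e y)" if "x \<in> carrier G" "y \<in> carrier G" for x y
      using that mult_A[OF that] e[of "x \<otimes> y"] e[of x] e[of y] W(1)
      by (intro eqI) (simp add: A.int_pow_mult)
    show "int (p ^ r) dvd e x" if "x \<in> N" for x
      using that M(2) N.subset by (subst e_one) auto
    show "\<not> int (p ^ r) dvd e u" using e_one u M(3) by blast
    then have "r \<noteq> 0" by (intro notI) simp
    then obtain r' where r': "r = Suc r'" using not0_implies_Suc by blast
    \<comment> \<open>This power of \<open>W\<close> is nontrivial, so \<open>?U\<close> is a power
      of it; thus \<open>e u\<close> is a multiple of \<open>p ^ r'\<close> modulo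
      \<open>p ^ r\<close>, and one more factor \<open>p\<close> kills it.\<close>
    have "W [^]\<^bsub>A\<^esub> (p ^ r') \<noteq> \<one>\<^bsub>A\<^esub>"
    proof
      assume "W [^]\<^bsub>A\<^esub> (p ^ r') = \<one>\<^bsub>A\<^esub>"
      then have "p ^ r dvd p ^ r'" using A.pow_eq_id[OF W(1)] r by simp
      then show False using r' p prime_gt_1_nat power_dvd_imp_le by fastforce
    qed
    moreover have "W [^]\<^bsub>A\<^esub> (p ^ r') = W [^]\<^bsub>A\<^esub> int (p ^ r')" by (simp only: int_pow_int)
    ultimately obtain i :: int where i: "?U = (W [^]\<^bsub>A\<^esub> int (p ^ r')) [^]\<^bsub>A\<^esub> i"
      using min W(1) by (metis A.int_pow_closed)
    then have "int (p ^ r) dvd e u - int (p ^ r') * i"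
      using e[OF u(1)] W(1) by (intro eqI) (simp add: A.int_pow_pow)
    then have "int (p ^ r) dvd int p * (e u - int (p ^ r') * i) + int (p ^ r) * i" by simp
    then show "int (p ^ r) dvd int p * e u" by (simp add: r' algebra_simps)
  qed
qed

section \<open>Center, commutators and their bilinearity in class at most 2\<close>

lemma (in group) mult_inv_cancel:
  assumes "x \<in> carrier G" "y \<in> carrier G"
  shows "x \<otimes> (inv x \<otimes> y) = y" and "inv x \<otimes> (x \<otimes> y) = y"
  using assms by (simp_all flip: m_assoc)

lemma (in group) centerD:
  assumes "z \<in> center G"
  shows "z \<in> carrier G" "\<And>g. g \<in> carrier G \<Longrightarrow> z \<otimes> g = g \<otimes> z"
  using assms by (auto simp: center_def)

lemma (in group) center_left_comm:
  assumes "z \<in> center G" "g \<in> carrier G" "h \<in> carrier G"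
  shows "g \<otimes> (z \<otimes> h) = z \<otimes> (g \<otimes> h)"
  using assms by (metis centerD m_assoc)

lemma (in group) subgroup_center: "subgroup (center G) G"
proof (rule subgroupI)
  show "center G \<subseteq> carrier G" by (auto simp: center_def)
  have "\<one> \<in> center G" by (simp add: center_def)
  then show "center G \<noteq> {}" by blast
next
  fix z assume z: "z \<in> center G"
  have "inv z \<otimes> g = g \<otimes> inv z" if g: "g \<in> carrier G" for g
  proof -
    have "inv (inv g \<otimes> z) = inv (z \<otimes> inv g)" using centerD[OF z] g by simp
    then show ?thesis using centerD(1)[OF z] g by (simp add: inv_mult_group)
  qed
  then show "inv z \<in> center G" using centerD(1)[OF z] by (simp add: center_def)
next
  fix y z assume y: "y \<in> center G" and z: "z \<in> center G"
  have "y \<otimes> z \<otimes> g = g \<otimes> (y \<otimes> z)" if g: "g \<in> carrier G" for g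
    using centerD[OF y] centerD[OF z] g by (metis m_assoc)
  then show "y \<otimes> z \<in> center G"
    using centerD(1)[OF y] centerD(1)[OF z] by (simp add: center_def)
qed

lemma (in group) commutator_closed [simp]:
  "x \<in> carrier G \<Longrightarrow> y \<in> carrier G \<Longrightarrow> commutator G x y \<in> carrier G"
  by (simp add: commutator_def)

lemma (in group) commutator_eq_one_iff:
  assumes "x \<in> carrier G" "y \<in> carrier G"
  shows "commutator G x y = \<one> \<longleftrightarrow> x \<otimes> y = y \<otimes> x"
proof -
  have "commutator G x y = inv (y \<otimes> x) \<otimes> (x \<otimes> y)"
    using assms by (simp add: commutator_def inv_mult_group m_assoc)
  also have "\<dots> = \<one> \<longleftrightarrow> x \<otimes> y = y \<otimes> x"
    using assms inv_solve_left'[of "\<one>" "y \<otimes> x" "x \<otimes> y"] by auto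
  finally show ?thesis .
qed

lemma (in group) commutator_center:
  assumes "z \<in> center G" "g \<in> carrier G"
  shows "commutator G z g = \<one>" "commutator G g z = \<one>"
  using assms centerD[OF assms(1)] by (simp_all add: commutator_eq_one_iff)

lemma (in group) center_iff_commutator:
  assumes "x \<in> carrier G"
  shows "x \<in> center G \<longleftrightarrow> (\<forall>g \<in> carrier G. commutator G x g = \<one>)"
  using assms by (auto simp: center_def commutator_eq_one_iff)

lemma (in group) gamma2_generated:
  "gamma2 G = generate G {commutator G x g | x g. x \<in> carrier G \<and> g \<in> carrier G}"
  by (simp add: gamma2_eq)

lemma (in group) commutator_in_gamma2:
  assumes "x \<in> carrier G" "y \<in> carrier G"
  shows "commutator G x y \<in> gamma2 G"
  unfolding gamma2_generated using assms by (blast intro: generate.incl)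

lemma (in group) gamma2_least:
  assumes "subgroup H G"
    and "\<And>x y. x \<in> carrier G \<Longrightarrow> y \<in> carrier G \<Longrightarrow> commutator G x y \<in> H"
  shows "gamma2 G \<subseteq> H"
  unfolding gamma2_generated by (rule generate_subgroup_incl[OF _ assms(1)]) (use assms(2) in blast)

lemma (in group) subgroup_gamma2: "subgroup (gamma2 G) G"
  by (simp add: derived_is_subgroup)

lemma (in group) gamma2_trivial_iff: "gamma2 G = {\<one>} \<longleftrightarrow> comm_group G"
proof
  assume *: "gamma2 G = {\<one>}"
  show "comm_group G"
  proof (rule group_comm_groupI)
    fix x y assume "x \<in> carrier G" "y \<in> carrier G"
    then show "x \<otimes> y = y \<otimes> x" using commutator_in_gamma2[of x y] * commutator_eq_one_iff by simp
  qed
next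
  assume "comm_group G"
  then show "gamma2 G = {\<one>}" by (simp add: comm_group.derived_eq_singleton)
qed

text \<open>In any group \<open>[x, g h] = [x, h] [x, g]^h\<close>; centrality of
  \<open>[x, g]\<close> removes the conjugation and lets the factors commute.\<close>

lemma (in group) commutator_mult_right:
  assumes "gamma2 G \<subseteq> center G" "x \<in> carrier G" "g \<in> carrier G" "h \<in> carrier G"
  shows "commutator G x (g \<otimes> h) = commutator G x g \<otimes> commutator G x h"
proof -
  have z: "commutator G x g \<in> center G" using commutator_in_gamma2 assms by blast
  have "commutator G x (g \<otimes> h) = inv x \<otimes> inv h \<otimes> x \<otimes> (commutator G x g \<otimes> h)"
    using assms(2-4) by (simp add: commutator_def inv_mult_group m_assoc mult_inv_cancel)
  also have "\<dots> = commutator G x g \<otimes> (inv x \<otimes> inv h \<otimes> x \<otimes> h)"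
    using assms(2-4) by (intro center_left_comm[OF z]) auto
  finally show ?thesis by (simp add: commutator_def)
qed

lemma (in group) commutator_mult_left:
  assumes "gamma2 G \<subseteq> center G" "x \<in> carrier G" "y \<in> carrier G" "g \<in> carrier G"
  shows "commutator G (x \<otimes> y) g = commutator G x g \<otimes> commutator G y g"
proof -
  have z: "commutator G x g \<in> center G" using commutator_in_gamma2 assms by blast
  have "commutator G (x \<otimes> y) g = inv y \<otimes> (commutator G x g \<otimes> (inv g \<otimes> y \<otimes> g))"
    using assms(2-4) by (simp add: commutator_def inv_mult_group m_assoc mult_inv_cancel)
  also have "\<dots> = commutator G x g \<otimes> (inv y \<otimes> (inv g \<otimes> y \<otimes> g))"
    using assms(2-4) by (intro center_left_comm[OF z]) auto
  finally show ?thesis using assms(2-4) by (simp add: commutator_def m_assoc)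
qed

lemma (in group) commutator_pow:
  fixes n :: nat
  assumes "gamma2 G \<subseteq> center G" "x \<in> carrier G" "g \<in> carrier G"
  shows "commutator G (x [^] n) g = commutator G x g [^] n"
    and "commutator G x (g [^] n) = commutator G x g [^] n"
proof -
  have "commutator G \<one> g = \<one>" "commutator G x \<one> = \<one>" using assms by (simp_all add: commutator_eq_one_iff)
  then show "commutator G (x [^] n) g = commutator G x g [^] n"
    and "commutator G x (g [^] n) = commutator G x g [^] n"
    using assms by (induction n) (simp_all add: commutator_mult_left commutator_mult_right)
qed

lemma (in group) subgroup_commutator_image:
  assumes "gamma2 G \<subseteq> center G" "x \<in> carrier G"
  shows "subgroup {commutator G x g | g. g \<in> carrier G} G"
proof -
  have "(\<lambda>g. commutator G x g) \<in> hom G G"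
    using assms by (auto intro!: homI simp: commutator_mult_right)
  then interpret group_hom G G "\<lambda>g. commutator G x g"
    by (simp add: group_hom_def group_hom_axioms_def is_group)
  show ?thesis using img_is_subgroup by (simp add: Setcompr_eq_image)
qed

text \<open>Commutators are sent to commutators of central elements, so the kernel contains them and
  the subgroup they generate.\<close>

lemma (in group) central_hom_gamma2:
  assumes f: "f \<in> hom G G" "\<And>x. x \<in> carrier G \<Longrightarrow> f x \<in> center G" and "x \<in> gamma2 G"
  shows "f x = \<one>"
proof -
  interpret f: group_hom G G f by (simp add: group_hom_def group_hom_axioms_def is_group f)
  have "commutator G x y \<in> kernel G G f" if xy: "x \<in> carrier G" "y \<in> carrier G" for x y
  proof -
    have "f (commutator G x y) = commutator G (f x) (f y)" using xy by (simp add: commutator_def)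
    also have "\<dots> = \<one>" using xy f by (intro commutator_center) auto
    finally show ?thesis using xy by (simp add: kernel_def)
  qed
  then have "gamma2 G \<subseteq> kernel G G f" by (intro gamma2_least f.subgroup_kernel)
  then show ?thesis using assms(3) by (auto simp: kernel_def)
qed

section \<open>Class preserving automorphisms, central automorphisms and homomorphisms into the
  center\<close>

text \<open>Conjugation by \<open>g\<close> moves \<open>x\<close> by the factor
  \<open>[x, g]\<close>, so centrality of all inner automorphisms puts every commutator into the
  center. Conversely, a class preserving map moves each point by some commutator.\<close>

lemma (in group) Aut_c_subset_Aut_z_iff:
  "Aut_c G \<subseteq> Aut_z G \<longleftrightarrow> gamma2 G \<subseteq> center G"
proof
  assume sub: "Aut_c G \<subseteq> Aut_z G"
  show "gamma2 G \<subseteq> center G"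
  proof (rule gamma2_least[OF subgroup_center])
    fix x g assume x: "x \<in> carrier G" and g: "g \<in> carrier G"
    \<comment> \<open>Restricted to the carrier, since elements of \<open>auto G\<close> are
      extensional.\<close>
    define \<alpha> where "\<alpha> = (\<lambda>x \<in> carrier G. inv g \<otimes> x \<otimes> g)"
    have "\<alpha> \<in> hom G G"
      by (rule homI) (use g in \<open>auto simp: \<alpha>_def m_assoc mult_inv_cancel\<close>)
    moreover have "bij_betw \<alpha> (carrier G) (carrier G)"
      by (rule bij_betw_byWitness[where f' = "\<lambda>x. g \<otimes> x \<otimes> inv g"])
        (use g in \<open>auto simp: \<alpha>_def m_assoc mult_inv_cancel\<close>)
    ultimately have "\<alpha> \<in> Aut_c G"
      using g by (auto simp: Aut_c_def auto_def Bij_def \<alpha>_def)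
    then have "inv x \<otimes> \<alpha> x \<in> center G" using sub x by (auto simp: Aut_z_def)
    then show "commutator G x g \<in> center G" using x g by (simp add: \<alpha>_def commutator_def m_assoc)
  qed
next
  assume sub: "gamma2 G \<subseteq> center G"
  show "Aut_c G \<subseteq> Aut_z G"
  proof
    fix \<alpha> assume \<alpha>: "\<alpha> \<in> Aut_c G"
    have "inv x \<otimes> \<alpha> x \<in> center G" if x: "x \<in> carrier G" for x
    proof -
      obtain g where g: "g \<in> carrier G" "\<alpha> x = inv g \<otimes> x \<otimes> g" using \<alpha> x by (auto simp: Aut_c_def)
      then have "inv x \<otimes> \<alpha> x = commutator G x g" using x by (simp add: commutator_def m_assoc)
      then show ?thesis using commutator_in_gamma2[OF x g(1)] sub by auto
    qed
    then show "\<alpha> \<in> Aut_z G" using \<alpha> by (simp add: Aut_c_def Aut_z_def)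
  qed
qed

text \<open>The factor \<open>inv x \<otimes> \<phi> x\<close> is central and can be moved past
  \<open>inv y\<close>.\<close>

lemma (in group) central_automorphism_displacement:
  assumes "\<phi> \<in> Aut_z G"
  shows "(\<lambda>x. inv x \<otimes> \<phi> x) \<in> hom G G"
proof (rule homI)
  have \<phi>: "\<phi> x \<in> carrier G" "\<phi> (x \<otimes> y) = \<phi> x \<otimes> \<phi> y" "inv x \<otimes> \<phi> x \<in> center G"
    if "x \<in> carrier G" "y \<in> carrier G" for x y
    using assms that by (auto simp: Aut_z_def auto_def hom_def)
  show "inv x \<otimes> \<phi> x \<in> carrier G" if "x \<in> carrier G" for x
    using that \<phi> by simp
  show "inv (x \<otimes> y) \<otimes> \<phi> (x \<otimes> y) = inv x \<otimes> \<phi> x \<otimes> (inv y \<otimes> \<phi> y)"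
    if xy: "x \<in> carrier G" "y \<in> carrier G" for x y
  proof -
    have "inv (x \<otimes> y) \<otimes> \<phi> (x \<otimes> y) = inv y \<otimes> ((inv x \<otimes> \<phi> x) \<otimes> \<phi> y)"
      using xy \<phi> by (simp add: inv_mult_group m_assoc)
    also have "\<dots> = (inv x \<otimes> \<phi> x) \<otimes> (inv y \<otimes> \<phi> y)"
      using xy \<phi> by (intro center_left_comm) auto
    finally show ?thesis .
  qed
qed

text \<open>Reduces the inclusion to homomorphisms into the center: if
  \<open>inv x \<otimes> \<phi> x = [x, g]\<close>, then \<open>\<phi> x\<close> is the conjugate of
  \<open>x\<close> by \<open>g\<close>.\<close>

lemma (in group) Aut_z_subset_Aut_c:
  assumes "\<And>f x. f \<in> hom G G \<Longrightarrow> (\<And>x. x \<in> carrier G \<Longrightarrow> f x \<in> center G) \<Longrightarrow> x \<in> carrier G \<Longrightarrow>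
    \<exists>g \<in> carrier G. f x = commutator G x g"
  shows "Aut_z G \<subseteq> Aut_c G"
proof
  fix \<phi> assume \<phi>: "\<phi> \<in> Aut_z G"
  have "\<exists>g \<in> carrier G. \<phi> x = inv g \<otimes> x \<otimes> g" if x: "x \<in> carrier G" for x
  proof -
    have \<phi>x: "\<phi> x \<in> carrier G" using \<phi> x by (auto simp: Aut_z_def auto_def hom_def)
    have "\<exists>g \<in> carrier G. inv x \<otimes> \<phi> x = commutator G x g"
      using assms[OF central_automorphism_displacement[OF \<phi>] _ x] \<phi> by (simp add: Aut_z_def)
    then obtain g where g: "g \<in> carrier G" "inv x \<otimes> \<phi> x = commutator G x g" by blast
    have "\<phi> x = x \<otimes> (inv x \<otimes> \<phi> x)" using x \<phi>x by (simp add: mult_inv_cancel)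
    also have "\<dots> = inv g \<otimes> x \<otimes> g"
      using x g by (simp add: commutator_def m_assoc mult_inv_cancel)
    finally show ?thesis using g(1) by blast
  qed
  then show "\<phi> \<in> Aut_c G" using \<phi> by (simp add: Aut_c_def Aut_z_def)
qed

text \<open>The map \<open>x \<mapsto> x \<otimes> f x\<close> is an endomorphism because
  \<open>f\<close> has central values. An element of its kernel equals \<open>inv (f x)\<close> and
  is central, so injectivity need only be tested on the center; finiteness then gives an
  automorphism.\<close>

lemma (in group) central_hom_class_preserving:
  assumes fin: "finite (carrier G)" and sub: "Aut_z G \<subseteq> Aut_c G"
    and f: "f \<in> hom G G" "\<And>x. x \<in> carrier G \<Longrightarrow> f x \<in> center G"
    and inj: "\<And>x. x \<in> center G \<Longrightarrow> x \<otimes> f x = \<one> \<Longrightarrow> x = \<one>"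
    and x: "x \<in> carrier G"
  obtains g where "g \<in> carrier G" "f x = commutator G x g"
proof -
  interpret f: group_hom G G f by (simp add: group_hom_def group_hom_axioms_def is_group f)
  define \<phi> where "\<phi> = (\<lambda>x \<in> carrier G. x \<otimes> f x)"
  have hom: "\<phi> \<in> hom G G"
  proof (rule homI)
    fix x y assume xy: "x \<in> carrier G" "y \<in> carrier G"
    have "x \<otimes> (y \<otimes> (f x \<otimes> f y)) = x \<otimes> (f x \<otimes> (y \<otimes> f y))"
      using center_left_comm[OF f(2)[OF xy(1)]] xy by simp
    then show "\<phi> (x \<otimes> y) = \<phi> x \<otimes> \<phi> y" using xy by (simp add: \<phi>_def m_assoc)
  qed (simp add: \<phi>_def)
  interpret \<phi>: group_hom G G \<phi> by (simp add: group_hom_def group_hom_axioms_def is_group hom)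
  have "inj_on \<phi> (carrier G)"
    unfolding \<phi>.inj_on_one_iff
  proof (intro allI impI)
    fix x assume x: "x \<in> carrier G" and "\<phi> x = \<one>"
    then have *: "x \<otimes> f x = \<one>" by (simp add: \<phi>_def)
    then have "x = inv (f x)" using x by (metis f.hom_closed inv_equality)
    then have "x \<in> center G" using f(2)[OF x] subgroup.m_inv_closed[OF subgroup_center] by metis
    then show "x = \<one>" using inj * by blast
  qed
  moreover have "\<phi> ` carrier G \<subseteq> carrier G" using \<phi>.hom_closed by blast
  ultimately have "bij_betw \<phi> (carrier G) (carrier G)"
    using fin endo_inj_surj by (simp add: bij_betw_def)
  then have "\<phi> \<in> Aut_z G"
    using hom f x by (auto simp: Aut_z_def auto_def Bij_def \<phi>_def mult_inv_cancel)
  then have "\<phi> \<in> Aut_c G" using sub by blast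
  then obtain g where g: "g \<in> carrier G" "\<phi> x = inv g \<otimes> x \<otimes> g" using x by (auto simp: Aut_c_def)
  have "f x = inv x \<otimes> \<phi> x" using x by (simp add: \<phi>_def mult_inv_cancel)
  then have "f x = commutator G x g" using g x by (simp add: commutator_def m_assoc)
  then show thesis using that g(1) by blast
qed

section \<open>Homomorphisms into the center built from exponent maps\<close>

lemma (in group) exponent_map_central_hom:
  fixes e :: "'a \<Rightarrow> int"
  assumes add: "\<And>x y. x \<in> carrier G \<Longrightarrow> y \<in> carrier G \<Longrightarrow> q dvd e (x \<otimes> y) - (e x + e y)"
    and c: "c \<in> center G" "int (ord c) dvd q"
  shows "(\<lambda>x. c [^] e x) \<in> hom G G" and "c [^] (i::int) \<in> center G"
proof -
  have cc: "c \<in> carrier G" using centerD(1)[OF c(1)] .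
  show "(\<lambda>x. c [^] e x) \<in> hom G G"
  proof (rule homI)
    fix x y assume xy: "x \<in> carrier G" "y \<in> carrier G"
    have "int (ord c) dvd e (x \<otimes> y) - (e x + e y)" using add[OF xy] c(2) by (rule dvd_trans[rotated])
    then have "c [^] (e x + e y) = c [^] e (x \<otimes> y)" using int_pow_eq[OF cc] by blast
    then show "c [^] e (x \<otimes> y) = c [^] e x \<otimes> c [^] e y" using cc by (simp add: int_pow_mult)
  qed (simp add: cc)
  show "c [^] i \<in> center G" by (rule subgroup_int_pow_closed[OF subgroup_center c(1)])
qed

lemma (in group) ord_prime_power:
  assumes "prime p" "order G = p ^ n" "x \<in> carrier G"
  obtains k where "ord x = p ^ k"
  using ord_dvd_group_order[OF assms(3)] assms(1,2) divides_primepow_nat by auto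

text \<open>If \<open>x \<otimes> c [^] e x = \<one>\<close>, then \<open>x\<close> is a power of \<open>c\<close>, and on the powers of \<open>c\<close> the map
  \<open>x \<mapsto> x \<otimes> c [^] e x\<close> is raising to the power \<open>1 + e c\<close>, which is prime to \<open>p\<close>.\<close>

lemma (in group) exponent_map_class_preserving:
  fixes e :: "'a \<Rightarrow> int"
  assumes p: "prime p" and ord: "order G = p ^ n" and sub: "Aut_z G \<subseteq> Aut_c G"
    and add: "\<And>x y. x \<in> carrier G \<Longrightarrow> y \<in> carrier G \<Longrightarrow> int (p ^ r) dvd e (x \<otimes> y) - (e x + e y)"
    and c: "c \<in> center G" "c [^] (p ^ r) = \<one>" "int p dvd e c"
    and x: "x \<in> carrier G"
  obtains g where "g \<in> carrier G" "c [^] e x = commutator G x g"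
proof -
  have fin: "finite (carrier G)"
    using ord p order_gt_0_iff_finite by (simp add: prime_gt_0_nat)
  have cc: "c \<in> carrier G" using centerD(1)[OF c(1)] .
  have ordc: "int (ord c) dvd int (p ^ r)" using c(2) pow_eq_id[OF cc] by (simp del: of_nat_power)
  note f = exponent_map_central_hom[OF add c(1) ordc]
  interpret f: group_hom G G "\<lambda>x. c [^] e x"
    by (simp add: group_hom_def group_hom_axioms_def f(1) group_axioms)
  have inj: "y = \<one>" if y: "y \<in> center G" "y \<otimes> c [^] e y = \<one>" for y
  proof -
    have yc: "y \<in> carrier G" using centerD(1)[OF y(1)] .
    define j where "j = - e y"
    have "y = inv (c [^] e y)" using y(2) yc cc by (metis int_pow_closed inv_equality)
    then have j: "y = c [^] j" using cc by (simp add: j_def int_pow_neg)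
    have "c [^] e y = (c [^] e c) [^] j" using f.hom_int_pow[OF cc, of j] j by simp
    then have "c [^] (j * (1 + e c)) = \<one>"
      using y(2) cc by (simp add: j int_pow_pow int_pow_mult algebra_simps)
    then have "int (ord c) dvd j * (1 + e c)" using int_pow_eq_id[OF cc] by blast
    moreover have "coprime (int (ord c)) (1 + e c)"
    proof -
      obtain k where k: "ord c = p ^ k" using ord_prime_power[OF p ord cc] .
      have "\<not> int p dvd 1 + e c"
        using c(3) p by (metis dvd_add_left_iff int_dvd_int_iff not_prime_unit of_nat_1)
      then have "coprime (int p) (1 + e c)" using p by (intro prime_imp_coprime) auto
      then show ?thesis by (simp add: k)
    qed
    ultimately have "int (ord c) dvd j" by (simp add: coprime_dvd_mult_left_iff)
    then show "y = \<one>" using int_pow_eq_id[OF cc] j by blast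
  qed
  show thesis
    using central_hom_class_preserving[OF fin sub f inj x] that by blast
qed

lemma (in group) exponent_map_pow:
  fixes e :: "'a \<Rightarrow> int" and k :: nat
  assumes add: "\<And>x y. x \<in> carrier G \<Longrightarrow> y \<in> carrier G \<Longrightarrow> q dvd e (x \<otimes> y) - (e x + e y)"
    and x: "x \<in> carrier G"
  shows "q dvd e (x [^] k) - int k * e x"
proof (induction k)
  case 0
  \<comment> \<open>Additivity at \<open>\<one>\<close> leaves \<open>q dvd - e \<one>\<close>,
    which is the base case.\<close>
  have "q dvd e (\<one> \<otimes> \<one>) - (e \<one> + e \<one>)" by (rule add) auto
  then show ?case by simp
next
  case (Suc k)
  have "q dvd (e (x [^] k \<otimes> x) - (e (x [^] k) + e x)) + (e (x [^] k) - int k * e x)"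
    by (intro dvd_add add Suc) (simp_all add: x)
  then show ?case by (simp add: algebra_simps)
qed

section \<open>Equality of the center and the commutator subgroup\<close>

lemma (in group) subgroup_has_element_of_prime_order:
  assumes p: "prime p" and ord: "order G = p ^ n"
    and H: "subgroup H G" "x \<in> H" "x \<noteq> \<one>"
  obtains c where "c \<in> H" "ord c = p"
proof -
  have x: "x \<in> carrier G" using subgroup.mem_carrier[OF H(1,2)] .
  obtain k where k: "ord x = p ^ k" using ord_prime_power[OF p ord x] .
  have "k \<noteq> 0" using k ord_eq_1[OF x] H(3) by (metis power_0)
  then obtain k' where k': "k = Suc k'" using not0_implies_Suc by blast
  have "ord (x [^] (p ^ k')) = p"
    using ord_pow[OF x, of "p ^ k'"] k k' prime_gt_0_nat[OF p] by simp
  moreover have "x [^] (p ^ k') \<in> H"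
    using subgroup_int_pow_closed[OF H(1,2), of "int (p ^ k')"] unfolding int_pow_int .
  ultimately show thesis using that by blast
qed

lemma (in group) center_subset_gamma2:
  assumes p: "prime p" and ord: "order G = p ^ n" and sub: "Aut_z G \<subseteq> Aut_c G"
    and class2: "gamma2 G \<subseteq> center G" and nonabelian: "\<not> comm_group G"
  shows "center G \<subseteq> gamma2 G"
proof (rule ccontr)
  assume "\<not> center G \<subseteq> gamma2 G"
  then obtain u where u: "u \<in> center G" "u \<notin> gamma2 G" by blast
  have uc: "u \<in> carrier G" using centerD(1)[OF u(1)] .
  obtain w r and e :: "'a \<Rightarrow> int" where w: "w \<in> carrier G" "int (p ^ r) dvd e w - 1"
    and add: "\<And>x y. x \<in> carrier G \<Longrightarrow> y \<in> carrier G \<Longrightarrow> int (p ^ r) dvd e (x \<otimes> y) - (e x + e y)"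
    and e0: "\<And>x. x \<in> gamma2 G \<Longrightarrow> int (p ^ r) dvd e x"
    and eu: "\<not> int (p ^ r) dvd e u" "int (p ^ r) dvd int p * e u"
    using separating_exponent_map[OF p ord subgroup_gamma2 order_refl uc u(2)] by metis
  \<comment> \<open>As \<open>u\<close> is central, \<open>[u, G]\<close> is trivial, and class
    preservation forces the value at \<open>u\<close> to be \<open>\<one>\<close>.\<close>
  have kills: "c [^] e u = \<one>" if c: "c \<in> center G" "c [^] (p ^ r) = \<one>" "int p dvd e c" for c
  proof -
    obtain g where "g \<in> carrier G" "c [^] e u = commutator G u g"
      using exponent_map_class_preserving[OF p ord sub add c uc] .
    then show ?thesis using commutator_center(1)[OF u(1)] by simp
  qed
  text \<open>It remains to find a \<open>c\<close> of order \<open>p\<^sup>r\<close>; if \<open>r \<ge> 2\<close> and no power of \<open>u\<close> will do, then the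
    order of \<open>u\<close> is less than \<open>p\<^sup>r\<close> and \<open>x \<mapsto> u [^] e x\<close> takes the value \<open>u \<notin> \<gamma>\<^sub>2(G)\<close>.\<close>
  have ord_not: "ord c \<noteq> p ^ r" if c: "c \<in> center G" "int p dvd e c" for c
  proof
    assume *: "ord c = p ^ r"
    have cc: "c \<in> carrier G" using centerD(1)[OF c(1)] .
    have "c [^] e u = \<one>" using c cc * by (intro kills) (simp_all add: pow_eq_id)
    then show False using int_pow_eq_id[OF cc] * eu(1) by simp
  qed
  have "r \<noteq> 0" using eu(1) by (intro notI) simp
  then consider "r = 1" | r' where "r = Suc (Suc r')" by (metis One_nat_def not0_implies_Suc)
  then show False
  proof cases
    case 1
    obtain x where x: "x \<in> gamma2 G" "x \<noteq> \<one>"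
      using nonabelian gamma2_trivial_iff subgroup.one_closed[OF subgroup_gamma2] by blast
    \<comment> \<open>For \<open>r = 1\<close> this is the forbidden order \<open>p ^ r\<close>, and
      \<open>p\<close> divides \<open>e c\<close> because \<open>e\<close> vanishes on
      \<open>gamma2 G\<close> modulo \<open>p\<close>.\<close>
    obtain c where c: "c \<in> gamma2 G" "ord c = p"
      using subgroup_has_element_of_prime_order[OF p ord subgroup_gamma2 x] .
    then show False using ord_not[of c] class2 e0[OF c(1)] 1 by auto
  next
    case 2
    \<comment> \<open>Cancelling one \<open>p\<close> leaves \<open>p ^ (r - 1)\<close> dividing
      \<open>e u\<close>, and \<open>r - 1\<close> is still positive.\<close>
    then have pu: "int p dvd e u" using eu(2) prime_gt_0_nat[OF p] by (auto simp: mult_dvd_mono)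
    obtain s where s: "ord u = p ^ s" using ord_prime_power[OF p ord uc] .
    show False
    proof (cases "s \<le> r")
      case True
      then have u1: "u [^] (p ^ r) = \<one>" using s uc by (simp add: pow_eq_id le_imp_power_dvd)
      have "int (ord u) dvd e w - 1" using w(2) True s by (metis dvd_trans int_dvd_int_iff le_imp_power_dvd)
      then have "u [^] e w = u" using int_pow_eq[OF uc, of 1 "e w"] uc by simp
      then obtain g where "g \<in> carrier G" "u = commutator G w g"
        using exponent_map_class_preserving[OF p ord sub add u(1) u1 pu w(1)] by metis
      then show False using commutator_in_gamma2 w(1) u(2) by blast
    next
      case False
      \<comment> \<open>Here \<open>r < s\<close>, so this power of \<open>u\<close> has order
        exactly \<open>p ^ r\<close>; its exponent inherits the factor \<open>p\<close> from
        \<open>e u\<close>.\<close>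
      define c where "c = u [^] (p ^ (s - r))"
      have "ord c = p ^ s div p ^ (s - r)"
        unfolding c_def using ord_pow[OF uc, of "p ^ (s - r)"] s prime_gt_0_nat[OF p]
        by (simp add: le_imp_power_dvd)
      also have "\<dots> = p ^ r" using False prime_gt_0_nat[OF p] by (simp flip: power_diff)
      finally have "ord c = p ^ r" .
      moreover have "c \<in> center G"
        using subgroup_int_pow_closed[OF subgroup_center u(1), of "int (p ^ (s - r))"]
        unfolding c_def int_pow_int .
      moreover have "int p dvd e c"
      proof -
        have "int p dvd int (p ^ r)" using \<open>r \<noteq> 0\<close> by (simp add: dvd_power)
        then have "int p dvd e c - int (p ^ (s - r)) * e u"
          unfolding c_def using exponent_map_pow[OF add uc] dvd_trans by blast
        then have "int p dvd (e c - int (p ^ (s - r)) * e u) + int (p ^ (s - r)) * e u"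
          using pu by (intro dvd_add dvd_mult)
        then show ?thesis by simp
      qed
      ultimately show False using ord_not by blast
    qed
  qed
qed

section \<open>Commutators of order dividing p: the Camina property\<close>

text \<open>\<open>G/Z(G)\<close> has exponent \<open>p\<close>, so an exponent map separating
  \<open>x\<close> from the center lives modulo \<open>p\<close>. There \<open>e x\<close> is
  invertible, so a suitable power \<open>c\<close> of \<open>z\<close> satisfies
  \<open>c [^] e x = z\<close>; class preservation makes this value a commutator
  \<open>[x, g]\<close>.\<close>

lemma (in group) camina_if_elementary:
  assumes p: "prime p" and ord: "order G = p ^ n" and sub: "Aut_z G \<subseteq> Aut_c G"
    and eq: "gamma2 G = center G"
    and elementary: "\<And>x g. x \<in> carrier G \<Longrightarrow> g \<in> carrier G \<Longrightarrow> commutator G x g [^] p = \<one>"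
    and x: "x \<in> carrier G" "x \<notin> center G" and z: "z \<in> center G"
  obtains g where "g \<in> carrier G" "z = commutator G x g"
proof -
  have class2: "gamma2 G \<subseteq> center G" using eq by simp
  have pow_center: "y [^] p \<in> center G" if "y \<in> carrier G" for y
    using that elementary commutator_pow(1)[OF class2] by (simp add: center_iff_commutator)
  obtain w r and e :: "'a \<Rightarrow> int" where w: "w \<in> carrier G" "int (p ^ r) dvd e w - 1"
    and add: "\<And>x y. x \<in> carrier G \<Longrightarrow> y \<in> carrier G \<Longrightarrow> int (p ^ r) dvd e (x \<otimes> y) - (e x + e y)"
    and e0: "\<And>x. x \<in> center G \<Longrightarrow> int (p ^ r) dvd e x"
    and ex: "\<not> int (p ^ r) dvd e x"
    using separating_exponent_map[OF p ord subgroup_center class2 x] by metis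
  \<comment> \<open>Modulo \<open>p ^ r\<close>, the exponent of the central element
    \<open>w [^] p\<close> is both \<open>0\<close> and \<open>p * e w\<close>, hence
    \<open>p\<close>; so \<open>r\<close> is at most 1.\<close>
  have 1: "int (p ^ r) dvd e (w [^] p)" by (intro e0 pow_center w)
  have 2: "int (p ^ r) dvd e (w [^] p) - int p * e w" by (rule exponent_map_pow[OF add w(1)])
  have 3: "int (p ^ r) dvd int p * (e w - 1)" using w(2) by (rule dvd_mult)
  have "int (p ^ r) dvd e (w [^] p) - (e (w [^] p) - int p * e w) - int p * (e w - 1)"
    by (rule dvd_diff[OF dvd_diff[OF 1 2] 3])
  then have "int (p ^ r) dvd int p" by (simp add: algebra_simps)
  then have "p ^ r dvd p ^ 1" by (simp del: of_nat_power)
  then have "r \<le> 1" using power_dvd_imp_le prime_gt_1_nat[OF p] by blast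
  moreover have "r \<noteq> 0" using ex by (intro notI) simp
  ultimately have r: "r = 1" by simp
  obtain j q where j: "e x * j = 1 - int p * q"
    using prime_not_dvd_inverse[OF p, of "e x"] ex r by auto
  \<comment> \<open>The center is generated by commutators, and the central elements whose
    \<open>p\<close>-th power is \<open>\<one>\<close> form a subgroup containing them.\<close>
  have "center G \<subseteq> {c \<in> center G. c [^] p = \<one>}"
    unfolding eq[symmetric]
  proof (rule gamma2_least)
    show "subgroup {c \<in> gamma2 G. c [^] p = \<one>} G" unfolding eq
    proof (rule subgroupI)
      show "{c \<in> center G. c [^] p = \<one>} \<noteq> {}"
        using subgroup.one_closed[OF subgroup_center] by fastforce
      fix a assume "a \<in> {c \<in> center G. c [^] p = \<one>}"
      then have a: "a \<in> center G" "a \<in> carrier G" "a [^] p = \<one>" using centerD(1) by auto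
      then show "inv a \<in> {c \<in> center G. c [^] p = \<one>}"
        using subgroup.m_inv_closed[OF subgroup_center] by (simp add: nat_pow_inv)
      fix b assume "b \<in> {c \<in> center G. c [^] p = \<one>}"
      then have b: "b \<in> center G" "b \<in> carrier G" "b [^] p = \<one>" using centerD(1) by auto
      have "(a \<otimes> b) [^] p = a [^] p \<otimes> b [^] p"
        using a b centerD(2)[OF a(1) b(2)] by (intro pow_mult_distrib)
      then show "a \<otimes> b \<in> {c \<in> center G. c [^] p = \<one>}"
        using a b subgroup.m_closed[OF subgroup_center] by simp
    qed (use centerD(1) in blast)
  qed (use commutator_in_gamma2 elementary in blast)
  then have zp: "z [^] p = \<one>" using z by blast
  have zc: "z \<in> carrier G" using centerD(1)[OF z] .
  \<comment> \<open>\<open>j\<close> inverts \<open>e x\<close> modulo \<open>p\<close> and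
    \<open>z [^] p = \<one>\<close>, so \<open>c [^] e x = z\<close>.\<close>
  define c where "c = z [^] j"
  have c: "c \<in> center G" unfolding c_def by (rule subgroup_int_pow_closed[OF subgroup_center z])
  have "c [^] (p ^ r) = (z [^] int p) [^] j"
    using zc by (simp add: c_def r int_pow_pow mult.commute flip: int_pow_int)
  then have c1: "c [^] (p ^ r) = \<one>" using zp by (simp add: int_pow_int)
  have "int p dvd e c" using e0[OF c] r by simp
  then obtain g where g: "g \<in> carrier G" "c [^] e x = commutator G x g"
    using exponent_map_class_preserving[OF p ord sub add c c1 _ x(1)] by blast
  have "int (ord z) dvd int p" using zp pow_eq_id[OF zc] by simp
  then have "z [^] (1::int) = z [^] (j * e x)"
    unfolding int_pow_eq[OF zc] using j by (simp add: mult.commute)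
  then have "c [^] e x = z" using zc by (simp add: c_def int_pow_pow)
  then show thesis using that g by simp
qed

section \<open>Commutators of large order and the cyclic center\<close>

text \<open>The coset of \<open>x [^] i \<otimes> g [^] j\<close> modulo the center determines its
  commutators with \<open>g\<close> and \<open>x\<close>, which are the \<open>i\<close>-th and
  \<open>j\<close>-th powers of \<open>[x, g]\<close>; so it determines \<open>i\<close> and
  \<open>j\<close> below the order of \<open>[x, g]\<close>.\<close>

lemma (in group) order_commutator_square_le:
  assumes fin: "finite (carrier G)" and class2: "gamma2 G \<subseteq> center G"
    and xg: "x \<in> carrier G" "g \<in> carrier G"
  shows "ord (commutator G x g) * ord (commutator G x g) \<le> card (rcosets (center G))"
proof -
  let ?c = "commutator G x g" and ?Z = "center G"
  let ?I = "{..<ord ?c}"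
  have c: "?c \<in> carrier G" using xg by simp
  define F where "F = (\<lambda>(i::nat, j::nat). ?Z #> (x [^] i \<otimes> g [^] j))"
  have comm: "commutator G x x = \<one>" "commutator G g g = \<one>"
    using xg by (simp_all add: commutator_eq_one_iff)
  have left: "commutator G (x [^] i \<otimes> g [^] j) g = ?c [^] i" for i j :: nat
    using xg comm by (simp add: commutator_mult_left[OF class2] commutator_pow[OF class2])
  have right: "commutator G x (x [^] i \<otimes> g [^] j) = ?c [^] j" for i j :: nat
    using xg comm by (simp add: commutator_mult_right[OF class2] commutator_pow[OF class2])
  have inj_pow: "i = j" if "?c [^] i = ?c [^] j" "i < ord ?c" "j < ord ?c" for i j
    using inj_onD[OF ord_inj[OF c], of i j] that by auto
  have "inj_on F (?I \<times> ?I)"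
  proof (rule inj_onI, clarify)
    fix i j i' j' assume lt: "i < ord ?c" "j < ord ?c" "i' < ord ?c" "j' < ord ?c"
      and "F (i, j) = F (i', j')"
    then have "x [^] i \<otimes> g [^] j \<in> ?Z #> (x [^] i' \<otimes> g [^] j')"
      using rcos_self[OF _ subgroup_center, of "x [^] i \<otimes> g [^] j"] xg by (simp add: F_def)
    then obtain z where z: "z \<in> ?Z" "x [^] i \<otimes> g [^] j = z \<otimes> (x [^] i' \<otimes> g [^] j')"
      by (auto simp: r_coset_def)
    have zc: "z \<in> carrier G" using centerD(1)[OF z(1)] .
    have "?c [^] i = ?c [^] i'"
      unfolding left[of i j, symmetric] left[of i' j', symmetric] z(2)
      using xg zc commutator_center[OF z(1)] by (simp add: commutator_mult_left[OF class2])
    moreover have "?c [^] j = ?c [^] j'"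
      unfolding right[of i j, symmetric] right[of i' j', symmetric] z(2)
      using xg zc commutator_center[OF z(1)] by (simp add: commutator_mult_right[OF class2])
    ultimately show "i = i' \<and> j = j'" using inj_pow lt by blast
  qed
  moreover have "F ` (?I \<times> ?I) \<subseteq> rcosets ?Z"
    using xg subgroup.subset[OF subgroup_center] by (auto simp: F_def intro!: rcosetsI)
  moreover have "finite (rcosets ?Z)" using fin by (simp add: RCOSETS_def)
  ultimately have "card (?I \<times> ?I) \<le> card (rcosets ?Z)" using card_inj_on_le by blast
  then show ?thesis by (simp add: card_cartesian_product)
qed

lemma (in group) cyclic_subgroup_iff:
  assumes "subgroup H G"
  shows "cyclic_group (G\<lparr>carrier := H\<rparr>) \<longleftrightarrow> (\<exists>h \<in> H. H = range (\<lambda>i::int. h [^] i))"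
proof -
  interpret H: group "G\<lparr>carrier := H\<rparr>" using assms subgroup_imp_group by blast
  show ?thesis using H.cyclic_group int_pow_consistent[OF assms] by (auto simp: image_def)
qed

lemma (in group) cyclic_center_if_not_elementary:
  assumes p: "prime p" and ord: "order G = p ^ 6" and class2: "gamma2 G \<subseteq> center G"
    and xg: "x \<in> carrier G" "g \<in> carrier G" and not1: "commutator G x g [^] p \<noteq> \<one>"
  shows "cyclic_group (G\<lparr>carrier := center G\<rparr>)"
proof -
  let ?c = "commutator G x g" and ?Z = "center G"
  have fin: "finite (carrier G)"
    using ord p order_gt_0_iff_finite by (simp add: prime_gt_0_nat)
  have c: "?c \<in> carrier G" "?c \<in> ?Z" using xg commutator_in_gamma2 class2 by auto
  obtain k where k: "ord ?c = p ^ k" using ord_prime_power[OF p ord c(1)] .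
  have "\<not> p ^ k dvd p ^ 1" using not1 pow_eq_id[OF c(1)] k by simp
  then have "2 \<le> k" by (metis le_imp_power_dvd not_less_eq_eq Suc_1 One_nat_def)
  then have large: "p ^ 2 \<le> ord ?c" using k prime_gt_1_nat[OF p] by (simp add: power_increasing)
  \<comment> \<open>The order \<open>p ^ 6\<close> enters here: the center has index at least
    \<open>p ^ 4\<close>, hence at most \<open>p ^ 2\<close> elements, no more than
    \<open>?c\<close> has powers.\<close>
  have "p ^ 2 * p ^ 2 * card ?Z \<le> card (rcosets ?Z) * card ?Z"
    using order_trans[OF mult_le_mono[OF large large] order_commutator_square_le[OF fin class2 xg]]
    by (rule mult_le_mono1)
  also have "\<dots> = p ^ 2 * p ^ 2 * p ^ 2"
    using lagrange[OF subgroup_center] ord by (simp flip: power_add)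
  finally have "card ?Z \<le> p ^ 2"
    by (rule mult_left_le_imp_le) (simp add: prime_gt_0_nat p)
  then have "card ?Z \<le> card (generate G {?c})" using large generate_pow_card[OF c(1)] by simp
  moreover have "generate G {?c} \<subseteq> ?Z"
    using generate_subgroup_incl[OF _ subgroup_center, of "{?c}"] c(2) by blast
  moreover have "finite ?Z" using fin subgroup.subset[OF subgroup_center] finite_subset by blast
  ultimately have "?Z = generate G {?c}" using card_seteq by metis
  then have "?Z = range (\<lambda>i::int. ?c [^] i)" using generate_pow[OF c(1)] by auto
  then show ?thesis using cyclic_subgroup_iff[OF subgroup_center] c(2) by blast
qed

section \<open>The converse: cyclic centers and Camina groups of class 2\<close>

text \<open>In the cyclic group \<open>Z\<close> the equation \<open>t [^] card H = \<one>\<close>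
  has at most \<open>card H\<close> solutions. By Lagrange all elements of \<open>H\<close> are
  solutions, so there are no others.\<close>

lemma (in group) subgroup_of_cyclic_eq:
  assumes fin: "finite (carrier G)" and Z: "subgroup Z G" "cyclic_group (G\<lparr>carrier := Z\<rparr>)"
    and H: "subgroup H G" "H \<subseteq> Z" and t: "t \<in> Z" "t [^] card H = \<one>"
  shows "t \<in> H"
proof -
  obtain z where z: "z \<in> Z" "Z = range (\<lambda>i::int. z [^] i)"
    using Z cyclic_subgroup_iff by blast
  have zc: "z \<in> carrier G" using subgroup.mem_carrier[OF Z(1) z(1)] .
  have fin_Z: "finite Z" using fin subgroup.subset[OF Z(1)] finite_subset by blast
  interpret Z: group "G\<lparr>carrier := Z\<rparr>" using Z(1) subgroup_imp_group by blast
  have "card H dvd card Z"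
    using Z.lagrange[OF subgroup_incl[OF H(1) Z(1) H(2)]] by (simp add: order_def) (metis dvd_triv_right)
  moreover have cardZ: "card Z = ord z"
    using generate_pow_card[OF zc] generate_pow[OF zc] z(2) by (simp add: full_SetCompr_eq)
  ultimately obtain m where m: "ord z = card H * m" by (metis dvdE)
  have "0 < card Z" using fin_Z z(1) by (auto simp: card_gt_0_iff)
  then have pos: "0 < card H" "0 < m" using m cardZ by simp_all
  define T where "T = {t \<in> Z. t [^] card H = \<one>}"
  have "T \<subseteq> (\<lambda>l. z [^] (int m * l)) ` {0..<int (card H)}"
  proof
    fix t assume "t \<in> T"
    then obtain i :: int where i: "t = z [^] i" "t [^] card H = \<one>" using z(2) by (auto simp: T_def)
    have "t [^] int (card H) = \<one>" using i(2) by (simp add: int_pow_int)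
    then have "z [^] (i * int (card H)) = \<one>" using i(1) zc by (simp add: int_pow_pow)
    then have "int (card H) * int m dvd i * int (card H)" using int_pow_eq_id[OF zc] m by simp
    then have "int m dvd i" using pos(1) by (simp add: mult.commute)
    then obtain l where l: "i = int m * l" ..
    \<comment> \<open>Reducing \<open>l\<close> modulo \<open>card H\<close> changes the exponent by
      a multiple of \<open>card H * m\<close>, the order of \<open>z\<close>; so
      \<open>card H\<close> values of \<open>l\<close> suffice.\<close>
    have "int m * l - int m * (l mod int (card H)) = int (card H) * int m * (l div int (card H))"
      by (simp add: minus_mod_eq_mult_div[symmetric] algebra_simps flip: right_diff_distrib)
    then have "int (ord z) dvd int m * l - int m * (l mod int (card H))" by (simp add: m)
    then have "t = z [^] (int m * (l mod int (card H)))" using int_pow_eq[OF zc] i(1) l by metis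
    then show "t \<in> (\<lambda>l. z [^] (int m * l)) ` {0..<int (card H)}" using pos(1) by auto
  qed
  then have "card T \<le> card {0..<int (card H)}"
    using card_image_le card_mono by (metis finite_atLeastLessThan_int finite_imageI order_trans)
  then have "card T \<le> card H" by simp
  moreover have "H \<subseteq> T"
  proof
    fix h assume h: "h \<in> H"
    interpret H: group "G\<lparr>carrier := H\<rparr>" using H(1) subgroup_imp_group by blast
    have "h [^] card H = \<one>"
      using H.pow_order_eq_1[of h] h by (simp add: order_def flip: nat_pow_consistent)
    then show "h \<in> T" using h H(2) by (auto simp: T_def)
  qed
  moreover have "finite T" using fin_Z by (simp add: T_def)
  ultimately have "H = T" by (metis card_seteq)
  moreover have "t \<in> T" using t by (simp add: T_def)
  ultimately show ?thesis by blast
qed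

lemma (in group) Aut_z_subset_Aut_c_if_cyclic:
  assumes fin: "finite (carrier G)" and eq: "gamma2 G = center G"
    and cyclic: "cyclic_group (G\<lparr>carrier := center G\<rparr>)"
  shows "Aut_z G \<subseteq> Aut_c G"
proof (rule Aut_z_subset_Aut_c)
  fix f x assume f: "f \<in> hom G G" "\<And>x. x \<in> carrier G \<Longrightarrow> f x \<in> center G" and x: "x \<in> carrier G"
  interpret f: group_hom G G f by (simp add: group_hom_def group_hom_axioms_def f(1) group_axioms)
  have class2: "gamma2 G \<subseteq> center G" using eq by simp
  define H where "H = {commutator G x g | g. g \<in> carrier G}"
  have H: "subgroup H G" unfolding H_def by (rule subgroup_commutator_image[OF class2 x])
  have HZ: "H \<subseteq> center G" using commutator_in_gamma2[OF x] class2 by (auto simp: H_def)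
  interpret H: group "G\<lparr>carrier := H\<rparr>" using H subgroup_imp_group by blast
  have "h [^] card H = \<one>" if "h \<in> H" for h
    using H.pow_order_eq_1[of h] that by (simp add: order_def flip: nat_pow_consistent)
  \<comment> \<open>By bilinearity this is the \<open>card H\<close>-th power of
    \<open>[x, g]\<close>, an element of \<open>H\<close>.\<close>
  then have "commutator G (x [^] card H) g = \<one>" if "g \<in> carrier G" for g
    using that x commutator_pow(1)[OF class2 x] by (auto simp: H_def)
  then have "x [^] card H \<in> gamma2 G" using x eq by (simp add: center_iff_commutator)
  then have "f (x [^] card H) = \<one>" using central_hom_gamma2[OF f] by blast
  then have "f x [^] card H = \<one>" using f.hom_nat_pow[OF x] by simp
  then have "f x \<in> H" using subgroup_of_cyclic_eq[OF fin subgroup_center cyclic H HZ] f(2)[OF x] by blast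
  then show "\<exists>g \<in> carrier G. f x = commutator G x g" by (auto simp: H_def)
qed

text \<open>By the index shift, \<open>lower_central G 2\<close> is generated by the
  \<open>[a, g]\<close> with \<open>a\<close> in \<open>gamma2 G\<close>, so it is trivial iff all
  these \<open>a\<close> are central. A trivial carrier would make \<open>gamma2 G\<close> trivial
  too, so minimality of 2 means that \<open>G\<close> is not abelian.\<close>

lemma (in group) nilpotent_of_class_2_iff:
  "nilpotent_of_class G 2 \<longleftrightarrow> gamma2 G \<subseteq> center G \<and> \<not> comm_group G"
proof -
  have l1: "lower_central G 1 = gamma2 G" by (simp add: gamma2_eq)
  have l2: "lower_central G 2 = {\<one>} \<longleftrightarrow> gamma2 G \<subseteq> center G"
  proof -
    let ?S = "{commutator G x g | x g. x \<in> gamma2 G \<and> g \<in> carrier G}"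
    have "lower_central G 2 = generate G ?S" using l1 by (simp add: numeral_2_eq_2)
    moreover have "?S \<subseteq> generate G ?S" by (blast intro: generate.incl)
    moreover have "\<one> \<in> generate G ?S" by (rule generate.one)
    moreover have "generate G ?S \<subseteq> {\<one>}" if "?S \<subseteq> {\<one>}"
      using generate_subgroup_incl[OF that triv_subgroup] .
    ultimately have "lower_central G 2 = {\<one>} \<longleftrightarrow> ?S \<subseteq> {\<one>}" by blast
    also have "\<dots> \<longleftrightarrow> gamma2 G \<subseteq> center G"
      using subgroup.mem_carrier[OF subgroup_gamma2] by (auto simp: center_iff_commutator subset_iff)
    finally show ?thesis .
  qed
  have "gamma2 G = {\<one>}" if "carrier G = {\<one>}"
    using that subgroup.subset[OF subgroup_gamma2] subgroup.one_closed[OF subgroup_gamma2] by blast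
  then show ?thesis
    unfolding nilpotent_of_class_def l2 using l1 gamma2_trivial_iff by (auto simp: less_2_cases_iff)
qed

text \<open>A central \<open>y\<close> outside \<open>gamma2 G\<close> would have trivial
  \<open>[y, G]\<close> containing \<open>gamma2 G\<close>, so the center lies in
  \<open>gamma2 G\<close>. Then the Camina condition covers every value \<open>f x\<close> with
  \<open>x\<close> outside \<open>gamma2 G\<close>, and \<open>f\<close> vanishes inside.\<close>

lemma (in group) Aut_z_subset_Aut_c_if_camina:
  assumes camina: "camina_pair p G (gamma2 G)" and class2: "gamma2 G \<subseteq> center G"
  shows "Aut_z G \<subseteq> Aut_c G"
proof (rule Aut_z_subset_Aut_c)
  have cover: "\<exists>g \<in> carrier G. z = commutator G y g"
    if "y \<in> carrier G" "y \<notin> gamma2 G" "z \<in> gamma2 G" for y z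
    using camina that unfolding camina_pair_def by blast
  have eq: "center G \<subseteq> gamma2 G"
  proof (rule ccontr)
    assume "\<not> center G \<subseteq> gamma2 G"
    then obtain y where y: "y \<in> center G" "y \<notin> gamma2 G" by blast
    then have "z = \<one>" if "z \<in> gamma2 G" for z
      using cover[OF centerD(1)[OF y(1)] y(2) that] commutator_center[OF y(1)] by auto
    then have "gamma2 G = {\<one>}" using subgroup.one_closed[OF subgroup_gamma2] by blast
    then show False using camina by (simp add: camina_pair_def)
  qed
  fix f x assume f: "f \<in> hom G G" "\<And>x. x \<in> carrier G \<Longrightarrow> f x \<in> center G" and x: "x \<in> carrier G"
  show "\<exists>g \<in> carrier G. f x = commutator G x g"
  proof (cases "x \<in> gamma2 G")
    case True
    then have "f x = commutator G x \<one>"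
      using central_hom_gamma2[OF f] x by (simp add: commutator_eq_one_iff[THEN iffD2])
    then show ?thesis by blast
  next
    case False
    then show ?thesis using cover[OF x] f(2)[OF x] eq by blast
  qed
qed

section \<open>The equivalence for groups of order p^6\<close>

theorem theorem4p4:
  fixes G :: "('a, 'b) monoid_scheme" and p :: nat
  assumes "prime p"
    and "group G"
    and "order G = p ^ 6"
    and "\<not> comm_group G"
  shows "Aut_c G = Aut_z G \<longleftrightarrow>
    (gamma2 G = center G \<and> cyclic_group (G\<lparr>carrier := center G\<rparr>)) \<or>
    (camina_p_group p G \<and> nilpotent_of_class G 2)"
proof -
  interpret group G by fact
  have fin: "finite (carrier G)"
    using assms(1,3) order_gt_0_iff_finite by (simp add: prime_gt_0_nat)
  show ?thesis
  proof
    assume "Aut_c G = Aut_z G"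
    then have sub: "Aut_z G \<subseteq> Aut_c G" and class2: "gamma2 G \<subseteq> center G"
      using Aut_c_subset_Aut_z_iff by auto
    have eq: "gamma2 G = center G"
      using center_subset_gamma2[OF assms(1,3) sub class2 assms(4)] class2 by (rule equalityI[rotated])
    show "(gamma2 G = center G \<and> cyclic_group (G\<lparr>carrier := center G\<rparr>)) \<or>
      (camina_p_group p G \<and> nilpotent_of_class G 2)"
    \<comment> \<open>A commutator of order larger than \<open>p\<close> makes the center cyclic; if
      there is none, the elementary case yields the Camina property.\<close>
    proof (cases "\<exists>x \<in> carrier G. \<exists>g \<in> carrier G. commutator G x g [^]\<^bsub>G\<^esub> p \<noteq> \<one>\<^bsub>G\<^esub>")
      case True
      then have "cyclic_group (G\<lparr>carrier := center G\<rparr>)"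
        using cyclic_center_if_not_elementary[OF assms(1,3) class2] by blast
      with eq show ?thesis by blast
    next
      case False
      have "gamma2 G \<subseteq> {commutator G y g | g. g \<in> carrier G}" if y: "y \<in> carrier G - gamma2 G" for y
      proof
        fix z assume z: "z \<in> gamma2 G"
        obtain g where "g \<in> carrier G" "z = commutator G y g"
          by (rule camina_if_elementary[OF assms(1,3) sub eq, of y z]) (use False y z eq in auto)
        then show "z \<in> {commutator G y g | g. g \<in> carrier G}" by blast
      qed
      moreover have "gamma2 G \<noteq> carrier G"
      proof
        assume "gamma2 G = carrier G"
        then have "comm_group G" using centerD(2) class2 by (intro group_comm_groupI) blast
        with assms(4) show False ..
      qed
      moreover have "gamma2 G \<lhd> G" by (rule derived_is_normal[OF normal_self])
      moreover have "gamma2 G \<noteq> {\<one>\<^bsub>G\<^esub>}" using gamma2_trivial_iff assms(4) by simp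
      ultimately have "camina_p_group p G"
        using assms(1-3) by (auto simp: camina_p_group_def camina_pair_def finite_p_group_def)
      then show ?thesis using nilpotent_of_class_2_iff class2 assms(4) by blast
    qed
  next
    assume "(gamma2 G = center G \<and> cyclic_group (G\<lparr>carrier := center G\<rparr>)) \<or>
      (camina_p_group p G \<and> nilpotent_of_class G 2)"
    \<comment> \<open>Both alternatives put \<open>gamma2 G\<close> inside the center, which is
      equivalent to the opposite inclusion of automorphism groups.\<close>
    then have "Aut_z G \<subseteq> Aut_c G \<and> gamma2 G \<subseteq> center G"
      using Aut_z_subset_Aut_c_if_cyclic[OF fin] Aut_z_subset_Aut_c_if_camina
        nilpotent_of_class_2_iff by (auto simp: camina_p_group_def)
    then show "Aut_c G = Aut_z G" using Aut_c_subset_Aut_z_iff by blast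
  qed
qed

end
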